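(* Fix $p>0$ and $r>0$. Let $X$ be a real random variable and, for each $d\ge1$, let $\mathbf{X}=(X_1,\dots,X_d)$ be a random vector whose components are i.i.d. copies of $X$. (i) Whenever $r/p<1$ and $\mathbb{E}|X|^p<\infty$, $$\frac{\mathbb{E}\Vert\mathbf{X}\Vert_p^r}{d^{r/p}}\to\mu_p^{r/p},\quad\text{as } d\to\infty,$$ whereas if $r/p<1$ and $\mathbb{E}|X|^p=\infty$, then $$\lim_{d\to\infty}\frac{\mathbb{E}\Vert\mathbf{X}\Vert_p^r}{d^{r/p}}=\infty.$$ (ii) Whenever $r/p\ge1$ and $\mathbb{E}|X|^r<\infty$, $$\frac{\mathbb{E}\Vert\mathbf{X}\Vert_p^r}{d^{r/p}}\to\mu_p^{r/p},\quad\text{as } d\to\infty,$$ whereas if $r/p\ge 1$ and $\mathbb{E}|X|^r=\infty$, then, for all $d\ge1$, $$\frac{\mathbb{E}\Vert\mathbf{X}\Vert_p^r}{d^{r/p}}=\infty.$$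
   Context: For $\mathbf{x}=(x_1,\dots,x_d)\in\mathbb{R}^d$ and $0<p<\infty$, $\Vert\mathbf{x}\Vert_p=\left(\sum_{j=1}^d|x_j|^p\right)^{1/p}$ (for all $p>0$, even when $p<1$ and this is not a norm). Notation: $\mu_p=\mathbb{E}|X|^p$ when this is finite. Expectations of nonnegative random variables take values in $[0,\infty]$. *)

theory Defs
  imports "HOL-Probability.Probability"
begin

text \<open>
  A vector in d-dimensional real space is a function on the natural numbers of which only the values at
  the indices 1, ..., d matter.  The definition is meant for \<open>p > 0\<close>; for \<open>p < 1\<close> it is
  not a norm.  Since \<open>0 powr a = 0\<close>, zero coordinates and the zero vector
  behave as expected.
\<close>

definition pnorm :: "real \<Rightarrow> nat \<Rightarrow> (nat \<Rightarrow> real) \<Rightarrow> real" where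
  "pnorm p d x = (\<Sum>j = 1..d. \<bar>x j\<bar> powr p) powr (1 / p)"

text \<open>
  The components \<open>Y 1, \<dots>, Y d\<close>, random variables on \<open>M\<close>, are i.i.d. copies
  of \<open>X\<close>, which may live on another probability space \<open>N\<close>.  Measurability of the components is
  part of \<open>indep_vars\<close>.
\<close>

definition iid_copies ::
    "'a measure \<Rightarrow> ('a \<Rightarrow> real) \<Rightarrow> 'b measure \<Rightarrow> nat \<Rightarrow> (nat \<Rightarrow> 'b \<Rightarrow> real) \<Rightarrow> bool" where
  "iid_copies N X M d Y \<longleftrightarrow>
     prob_space.indep_vars M (\<lambda>_. borel) Y {1..d} \<and>
     (\<forall>j\<in>{1..d}. distr M borel (Y j) = distr N borel X)"

text \<open>
  Absolute moments with values in \<open>[0, \<infinity>]\<close>, and their real-valued version, to be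
  used only where the former is finite (the Bochner integral is \<open>0\<close> otherwise).
\<close>

definition abs_moment :: "'a measure \<Rightarrow> ('a \<Rightarrow> real) \<Rightarrow> real \<Rightarrow> ennreal" where
  "abs_moment N X q = (\<integral>\<^sup>+ \<omega>. ennreal (\<bar>X \<omega>\<bar> powr q) \<partial>N)"

definition mu :: "'a measure \<Rightarrow> ('a \<Rightarrow> real) \<Rightarrow> real \<Rightarrow> real" where
  "mu N X q = (\<integral> \<omega>. \<bar>X \<omega>\<bar> powr q \<partial>N)"

definition scaled_pnorm_moment ::
    "real \<Rightarrow> real \<Rightarrow> 'b measure \<Rightarrow> nat \<Rightarrow> (nat \<Rightarrow> 'b \<Rightarrow> real) \<Rightarrow> ennreal" where
  "scaled_pnorm_moment p r M d Y =
     (\<integral>\<^sup>+ \<omega>. ennreal (pnorm p d (\<lambda>j. Y j \<omega>) powr r) \<partial>M) / ennreal (real d powr (r / p))"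

end

theory Submission
  imports Defs
begin

text \<open>
  With \<open>Z = |X|\<^sup>p\<close> and \<open>s = r / p\<close>, the scaled moment is the \<open>s\<close>-th moment of the mean
  \<open>A\<^sub>d\<close> of \<open>d\<close> i.i.d. copies of \<open>Z\<close>.  For bounded \<open>Z\<close> it converges by Hoeffding's
  inequality, so truncating \<open>Z\<close> at \<open>K\<close> and letting \<open>K \<longlonglongrightarrow> \<infinity>\<close> bounds the limit inferior from
  below by \<open>(E Z)\<^sup>s\<close>, also when \<open>E Z = \<infinity>\<close>.  From above, concavity suffices when \<open>s < 1\<close>.  When
  \<open>s \<ge> 1\<close>, convexity gives \<open>(a + b)\<^sup>s \<le> (1 - t)\<^bsup>1-s\<^esup> a\<^sup>s + t\<^bsup>1-s\<^esup> b\<^sup>s\<close> for \<open>0 < t < 1\<close>; apply this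
  to the truncated mean and the mean of the excesses \<open>(Z - K)\<^sup>+\<close>, let \<open>K \<longlonglongrightarrow> \<infinity>\<close> and then
  \<open>t \<longlonglongrightarrow> 0\<close>.
\<close>

section \<open>Sample means and transfer along i.i.d. copies\<close>

text \<open>At \<open>d = 0\<close> the value is \<open>0 / 0 = 0\<close>, so the pointwise bounds
  below hold for every \<open>d\<close>; this is why \<open>sample_mean_le\<close> asks for
  \<open>0 \<le> K\<close>.\<close>

definition sample_mean :: "nat \<Rightarrow> (nat \<Rightarrow> 'b \<Rightarrow> real) \<Rightarrow> 'b \<Rightarrow> real" where
  "sample_mean d Z \<omega> = (\<Sum>j = 1..d. Z j \<omega>) / real d"

lemma iid_copiesD:
  assumes "iid_copies N X M d Y" "prob_space M" "j \<in> {1..d}"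
  shows iid_copies_measurable: "Y j \<in> borel_measurable M"
    and iid_copies_distr: "distr M borel (Y j) = distr N borel X"
  using assms by (auto simp: iid_copies_def prob_space.indep_vars_def)

text \<open>Independence and equality of laws survive a Borel map. This is applied to absolute
  powers, truncations and powers of excesses.\<close>

lemma iid_copies_compose:
  assumes iid: "iid_copies N X M d Y" and "prob_space M"
    and X: "X \<in> borel_measurable N" and [measurable]: "g \<in> borel_measurable borel"
  shows "iid_copies N (\<lambda>\<omega>. g (X \<omega>)) M d (\<lambda>j \<omega>. g (Y j \<omega>))"
proof -
  interpret prob_space M by fact
  have "distr M borel (\<lambda>\<omega>. g (Y j \<omega>)) = distr N borel (\<lambda>\<omega>. g (X \<omega>))" if j: "j \<in> {1..d}" for j
  proof -
    have "distr M borel (\<lambda>\<omega>. g (Y j \<omega>)) = distr (distr M borel (Y j)) borel g"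
      using iid_copies_measurable[OF iid \<open>prob_space M\<close> j] by (simp add: distr_distr comp_def)
    also have "\<dots> = distr N borel (\<lambda>\<omega>. g (X \<omega>))"
      using X by (simp add: iid_copies_distr[OF iid \<open>prob_space M\<close> j] distr_distr comp_def)
    finally show ?thesis .
  qed
  moreover have "indep_vars (\<lambda>_. borel) (\<lambda>j \<omega>. g (Y j \<omega>)) {1..d}"
  proof (rule indep_vars_compose2[where X = Y and M' = "\<lambda>_. borel"])
    show "indep_vars (\<lambda>_. borel) Y {1..d}" using iid by (simp add: iid_copies_def)
  qed simp
  ultimately show ?thesis by (simp add: iid_copies_def)
qed

text \<open>Both sides are the integral of \<open>f\<close> against the common law, so the two
  random variables may live on different spaces.\<close>

lemma iid_copies_nn_integral:
  assumes iid: "iid_copies N X M d Y" and M: "prob_space M" and j: "j \<in> {1..d}"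
    and X: "X \<in> borel_measurable N" and [measurable]: "f \<in> borel_measurable borel"
  shows "(\<integral>\<^sup>+\<omega>. f (Y j \<omega>) \<partial>M) = (\<integral>\<^sup>+\<omega>. f (X \<omega>) \<partial>N)"
proof -
  have "(\<integral>\<^sup>+\<omega>. f (Y j \<omega>) \<partial>M) = (\<integral>\<^sup>+x. f x \<partial>distr M borel (Y j))"
    using iid_copies_measurable[OF iid M j] by (simp add: nn_integral_distr)
  also have "\<dots> = (\<integral>\<^sup>+\<omega>. f (X \<omega>) \<partial>N)"
    using X by (simp add: iid_copies_distr[OF iid M j] nn_integral_distr)
  finally show ?thesis .
qed

lemma iid_copies_integral:
  fixes f :: "real \<Rightarrow> real"
  assumes iid: "iid_copies N X M d Y" and M: "prob_space M" and j: "j \<in> {1..d}"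
    and X: "X \<in> borel_measurable N" and [measurable]: "f \<in> borel_measurable borel"
  shows "(\<integral>\<omega>. f (Y j \<omega>) \<partial>M) = (\<integral>\<omega>. f (X \<omega>) \<partial>N)"
proof -
  have "(\<integral>\<omega>. f (Y j \<omega>) \<partial>M) = (\<integral>x. f x \<partial>distr M borel (Y j))"
    using iid_copies_measurable[OF iid M j] by (simp add: integral_distr)
  also have "\<dots> = (\<integral>\<omega>. f (X \<omega>) \<partial>N)"
    using X by (simp add: iid_copies_distr[OF iid M j] integral_distr)
  finally show ?thesis .
qed

lemma sample_mean_measurable:
  assumes "iid_copies N X M d Y" "prob_space M"
  shows "sample_mean d Y \<in> borel_measurable M"
  using iid_copies_measurable[OF assms] unfolding sample_mean_def [abs_def]
  by (intro borel_measurable_divide borel_measurable_sum) auto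

lemma sample_mean_nonneg: "(\<And>j. 0 \<le> Z j \<omega>) \<Longrightarrow> 0 \<le> sample_mean d Z \<omega>"
  by (simp add: sample_mean_def sum_nonneg)

lemma sample_mean_le:
  assumes "\<And>j. Z j \<omega> \<le> K" "0 \<le> K"
  shows "sample_mean d Z \<omega> \<le> K"
proof (cases "d = 0")
  case False
  have "(\<Sum>j = 1..d. Z j \<omega>) \<le> (\<Sum>j = 1..d. K)" by (intro sum_mono assms)
  then show ?thesis using False by (simp add: sample_mean_def field_simps)
qed (use assms in \<open>simp add: sample_mean_def\<close>)

lemma sample_mean_mono:
  "(\<And>j. Z j \<omega> \<le> W j \<omega>) \<Longrightarrow> sample_mean d Z \<omega> \<le> sample_mean d W \<omega>"
  by (simp add: sample_mean_def sum_mono divide_right_mono)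

section \<open>Bounded variables: convergence by Hoeffding's inequality\<close>

lemma prob_sample_mean_deviation:
  assumes "K > 0" "\<delta> > 0" "d \<ge> 1" "prob_space M" "X \<in> borel_measurable N"
    and iid: "iid_copies N X M d Y" and Y: "\<And>j \<omega>. Y j \<omega> \<in> {0..K}"
  shows "measure M {\<omega> \<in> space M. \<delta> \<le> \<bar>sample_mean d Y \<omega> - (\<integral>\<omega>. X \<omega> \<partial>N)\<bar>}
           \<le> 2 * exp (- 2 * real d * \<delta>\<^sup>2 / K\<^sup>2)"
proof -
  interpret prob_space M by fact
  let ?m = "\<integral>\<omega>. X \<omega> \<partial>N"
  have exp: "expectation (Y j) = ?m" if "j \<in> {1..d}" for j
    using iid_copies_integral[OF iid \<open>prob_space M\<close> that \<open>X \<in> _\<close>, of "\<lambda>x. x"] by simp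
  interpret Hoeffding_ineq M "{1..d}" Y "\<lambda>_. 0" "\<lambda>_. K" "\<Sum>j\<in>{1..d}. expectation (Y j)"
    by unfold_locales (use iid Y in \<open>auto simp: iid_copies_def\<close>)
  have "{\<omega> \<in> space M. \<delta> \<le> \<bar>sample_mean d Y \<omega> - ?m\<bar>} =
        {\<omega> \<in> space M. \<bar>(\<Sum>j\<in>{1..d}. Y j \<omega>) - (\<Sum>j\<in>{1..d}. expectation (Y j))\<bar> \<ge> real d * \<delta>}"
  proof -
    have "(\<delta> \<le> \<bar>sample_mean d Y \<omega> - ?m\<bar>) =
        (\<bar>(\<Sum>j\<in>{1..d}. Y j \<omega>) - (\<Sum>j\<in>{1..d}. expectation (Y j))\<bar> \<ge> real d * \<delta>)" for \<omega>
    proof -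
      have "(\<Sum>j\<in>{1..d}. expectation (Y j)) = real d * ?m" using exp by simp
      then have "\<bar>(\<Sum>j\<in>{1..d}. Y j \<omega>) - (\<Sum>j\<in>{1..d}. expectation (Y j))\<bar> = \<bar>real d * (sample_mean d Y \<omega> - ?m)\<bar>"
        using \<open>d \<ge> 1\<close> by (simp add: sample_mean_def right_diff_distrib)
      also have "\<dots> = real d * \<bar>sample_mean d Y \<omega> - ?m\<bar>" by (simp add: abs_mult)
      finally show ?thesis using \<open>d \<ge> 1\<close> by simp
    qed
    then show ?thesis by simp
  qed
  also have "prob \<dots> \<le> 2 * exp (- 2 * (real d * \<delta>)\<^sup>2 / (\<Sum>j\<in>{1..d}. (K - 0)\<^sup>2))"
    using assms by (intro Hoeffding_ineq_abs_ge) (auto intro!: sum_pos)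
  also have "\<dots> = 2 * exp (- 2 * real d * \<delta>\<^sup>2 / K\<^sup>2)"
    using assms by (simp add: power2_eq_square field_simps)
  finally show ?thesis .
qed

text \<open>The vectors for different \<open>d\<close> live on unrelated spaces \<open>M d\<close>,
  so almost sure convergence is not at hand. Instead the error is split: where the mean is close to
  its expectation, continuity of the power controls it; elsewhere it is bounded, on an event of
  exponentially small probability.\<close>

lemma sample_mean_powr_bounded_LIMSEQ:
  fixes M :: "nat \<Rightarrow> 'b measure"
  assumes "K > 0" "s > 0" "prob_space N" and X: "X \<in> borel_measurable N" "\<And>\<omega>. X \<omega> \<in> {0..K}"
    and M: "\<And>d. d \<ge> 1 \<Longrightarrow> prob_space (M d)"
    and iid: "\<And>d. d \<ge> 1 \<Longrightarrow> iid_copies N X (M d) d (Y d)"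
    and Y: "\<And>d j \<omega>. Y d j \<omega> \<in> {0..K}"
  shows "(\<lambda>d. \<integral>\<^sup>+\<omega>. ennreal (sample_mean d (Y d) \<omega> powr s) \<partial>M d)
           \<longlonglongrightarrow> ennreal ((\<integral>\<omega>. X \<omega> \<partial>N) powr s)"
proof -
  interpret N: prob_space N by fact
  let ?m = "\<integral>\<omega>. X \<omega> \<partial>N"
  let ?A = "\<lambda>d. sample_mean d (Y d)"
  have A: "0 \<le> ?A d \<omega>" "?A d \<omega> \<le> K" for d \<omega>
    using Y \<open>K > 0\<close> by (auto intro!: sample_mean_nonneg sample_mean_le)
  have int_X: "integrable N X"
    using X by (intro N.integrable_const_bound[where B = K]) auto
  have m: "0 \<le> ?m" "?m \<le> K"
    using X N.integral_le_const[OF int_X, of K] by auto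
  have powr_le: "x powr s \<le> K powr s" if "0 \<le> x" "x \<le> K" for x
    using that \<open>s > 0\<close> by (intro powr_mono2) auto
  have int: "integrable (M d) (\<lambda>\<omega>. ?A d \<omega> powr s)" if "d \<ge> 1" for d
  proof -
    interpret prob_space "M d" using M that .
    have [measurable]: "?A d \<in> borel_measurable (M d)"
      using iid[OF that] M[OF that] by (rule sample_mean_measurable)
    show ?thesis using A powr_le
      by (intro integrable_const_bound[where B = "K powr s"]) auto
  qed
  have "(\<lambda>d. \<integral>\<omega>. ?A d \<omega> powr s \<partial>M d) \<longlonglongrightarrow> ?m powr s"
  proof (rule LIMSEQ_I)
    fix e :: real assume "e > 0"
    \<comment> \<open>The absolute value keeps the base nonnegative near \<open>?m\<close>, which
      may be \<open>0\<close>. It disappears in \<open>close\<close>, as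
      \<open>?A d \<omega>\<close> and \<open>?m\<close> are nonnegative.\<close>
    have "isCont (\<lambda>x. \<bar>x\<bar> powr s) ?m"
      using \<open>s > 0\<close> unfolding isCont_def by (intro tendsto_intros) (auto simp: eventually_at_filter)
    then obtain \<delta> where \<delta>: "\<delta> > 0"
      and "\<And>x. \<bar>x - ?m\<bar> < \<delta> \<Longrightarrow> \<bar>\<bar>x\<bar> powr s - \<bar>?m\<bar> powr s\<bar> < e / 2"
      using \<open>e > 0\<close> unfolding continuous_at_eps_delta dist_real_def by (metis half_gt_zero)
    then have close: "\<bar>?A d \<omega> powr s - ?m powr s\<bar> < e / 2" if "\<bar>?A d \<omega> - ?m\<bar> < \<delta>" for d \<omega>
      using that A[of d \<omega>] m by fastforce
    \<comment> \<open>The exponential factor is a geometric sequence in \<open>d\<close> with ratio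
      below 1.\<close>
    have "(\<lambda>d. K powr s * (2 * exp (- 2 * real d * \<delta>\<^sup>2 / K\<^sup>2))) \<longlonglongrightarrow> K powr s * (2 * 0)"
    proof (intro tendsto_intros)
      have "(\<lambda>d. exp (- (2 * \<delta>\<^sup>2 / K\<^sup>2)) ^ d) \<longlonglongrightarrow> 0"
        using \<delta> \<open>K > 0\<close> by (intro LIMSEQ_power_zero) auto
      then show "(\<lambda>d. exp (- 2 * real d * \<delta>\<^sup>2 / K\<^sup>2)) \<longlonglongrightarrow> 0"
        by (simp add: exp_of_nat_mult[symmetric] mult_ac)
    qed
    then have "eventually (\<lambda>d. K powr s * (2 * exp (- 2 * real d * \<delta>\<^sup>2 / K\<^sup>2)) < e / 2) sequentially"
      using \<open>e > 0\<close> by (intro order_tendstoD) auto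
    then obtain d0 where d0: "\<And>d. d \<ge> d0 \<Longrightarrow> K powr s * (2 * exp (- 2 * real d * \<delta>\<^sup>2 / K\<^sup>2)) < e / 2"
      by (auto simp: eventually_sequentially)
    show "\<exists>n0. \<forall>d\<ge>n0. norm ((\<integral>\<omega>. ?A d \<omega> powr s \<partial>M d) - ?m powr s) < e"
    proof (intro exI allI impI)
      fix d assume "d \<ge> max d0 1"
      then have d: "d \<ge> d0" "d \<ge> 1" by auto
      interpret prob_space "M d" using M d(2) .
      have [measurable]: "?A d \<in> borel_measurable (M d)"
        using iid[OF d(2)] M[OF d(2)] by (rule sample_mean_measurable)
      define B where "B = {\<omega> \<in> space (M d). \<delta> \<le> \<bar>?A d \<omega> - ?m\<bar>}"
      have [measurable]: "B \<in> sets (M d)" by (simp add: B_def)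
      \<comment> \<open>On \<open>B\<close> both powers lie between \<open>0\<close> and
        \<open>K powr s\<close>; off \<open>B\<close> the bound \<open>close\<close>
        applies.\<close>
      have bd: "\<bar>?A d \<omega> powr s - ?m powr s\<bar> \<le> e / 2 + K powr s * indicator B \<omega>" if "\<omega> \<in> space (M d)" for \<omega>
      proof (cases "\<omega> \<in> B")
        case True
        have "0 \<le> ?A d \<omega> powr s" "0 \<le> ?m powr s" by auto
        with powr_le[OF A, of d \<omega>] powr_le[OF m] \<open>e > 0\<close>
        have "\<bar>?A d \<omega> powr s - ?m powr s\<bar> \<le> e / 2 + K powr s" by linarith
        with True show ?thesis by simp
      next
        case False
        then show ?thesis using close[of d \<omega>] that by (force simp: B_def)
      qed
      have "\<bar>(\<integral>\<omega>. ?A d \<omega> powr s \<partial>M d) - ?m powr s\<bar> = \<bar>\<integral>\<omega>. ?A d \<omega> powr s - ?m powr s \<partial>M d\<bar>"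
        using int[OF d(2)] by (simp add: prob_space)
      also have "\<dots> \<le> (\<integral>\<omega>. \<bar>?A d \<omega> powr s - ?m powr s\<bar> \<partial>M d)"
        by (rule integral_abs_bound)
      also have "\<dots> \<le> (\<integral>\<omega>. e / 2 + K powr s * indicator B \<omega> \<partial>M d)"
        using int[OF d(2)] bd
        by (intro integral_mono integrable_abs Bochner_Integration.integrable_diff
              Bochner_Integration.integrable_add integrable_mult_right) (auto simp: emeasure_eq_measure)
      also have "\<dots> = e / 2 + K powr s * prob B"
        by (simp add: prob_space emeasure_eq_measure)
      also have "\<dots> \<le> e / 2 + K powr s * (2 * exp (- 2 * real d * \<delta>\<^sup>2 / K\<^sup>2))"
        unfolding B_def using \<delta> \<open>K > 0\<close> d X iid[OF d(2)] Y
        by (intro add_left_mono mult_left_mono prob_sample_mean_deviation) (auto intro: M)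
      also have "\<dots> < e" using d0[OF d(1)] by simp
      finally show "norm ((\<integral>\<omega>. ?A d \<omega> powr s \<partial>M d) - ?m powr s) < e" by simp
    qed
  qed
  then have "(\<lambda>d. ennreal (\<integral>\<omega>. ?A d \<omega> powr s \<partial>M d)) \<longlonglongrightarrow> ennreal (?m powr s)"
    by (rule tendsto_ennrealI)
  \<comment> \<open>Nothing is assumed about \<open>M 0\<close>, so the two kinds of integral are
    compared for \<open>d \<ge> 1\<close> only.\<close>
  moreover have "\<forall>\<^sub>F d in sequentially. ennreal (\<integral>\<omega>. ?A d \<omega> powr s \<partial>M d) = (\<integral>\<^sup>+\<omega>. ennreal (?A d \<omega> powr s) \<partial>M d)"
    using eventually_ge_at_top[of "1::nat"]
    by eventually_elim (rule nn_integral_eq_integral[symmetric], rule int, auto)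
  ultimately show ?thesis
    by (rule Lim_transform_eventually)
qed


section \<open>Expectation of the sample mean and convexity inequalities\<close>

lemma nn_integral_sample_mean:
  assumes iid: "iid_copies N X M d Y" and M: "prob_space M" and "d \<ge> 1"
    and X: "X \<in> borel_measurable N" and nonneg: "\<And>j \<omega>. 0 \<le> Y j \<omega>"
  shows "(\<integral>\<^sup>+\<omega>. ennreal (sample_mean d Y \<omega>) \<partial>M) = (\<integral>\<^sup>+\<omega>. ennreal (X \<omega>) \<partial>N)"
proof -
  note [measurable] = iid_copies_measurable[OF iid M]
  have "(\<integral>\<^sup>+\<omega>. ennreal (sample_mean d Y \<omega>) \<partial>M) = (\<integral>\<^sup>+\<omega>. ennreal (1 / real d) * (\<Sum>j = 1..d. ennreal (Y j \<omega>)) \<partial>M)"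
    using nonneg by (intro nn_integral_cong) (simp add: sample_mean_def ennreal_mult[symmetric] sum_nonneg)
  also have "\<dots> = ennreal (1 / real d) * (\<integral>\<^sup>+\<omega>. (\<Sum>j = 1..d. ennreal (Y j \<omega>)) \<partial>M)"
    by (intro nn_integral_cmult borel_measurable_sum) simp
  also have "(\<integral>\<^sup>+\<omega>. (\<Sum>j = 1..d. ennreal (Y j \<omega>)) \<partial>M) = (\<Sum>j = 1..d. \<integral>\<^sup>+\<omega>. ennreal (Y j \<omega>) \<partial>M)"
    by (intro nn_integral_sum) simp
  also have "\<dots> = (\<Sum>j = 1..d. \<integral>\<^sup>+\<omega>. ennreal (X \<omega>) \<partial>N)"
    by (intro sum.cong refl iid_copies_nn_integral[OF iid M _ X, where f = ennreal]) auto
  also have "ennreal (1 / real d) * \<dots> = (ennreal (1 / real d) * ennreal (real d)) * (\<integral>\<^sup>+\<omega>. ennreal (X \<omega>) \<partial>N)"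
    by (simp add: mult.assoc ennreal_of_nat_eq_real_of_nat)
  also have "ennreal (1 / real d) * ennreal (real d) = 1"
    using \<open>d \<ge> 1\<close> by (simp add: ennreal_mult[symmetric])
  finally show ?thesis by simp
qed

text \<open>Convexity on the positive half-line is extended to the endpoint \<open>0\<close>. A
  chord starting there only needs \<open>t powr s \<le> t\<close>, which holds for
  \<open>0 < t < 1\<close> and \<open>s \<ge> 1\<close>.\<close>

lemma powr_convex_on_nonneg:
  fixes s :: real
  assumes "s \<ge> 1"
  shows "convex_on {0..} (\<lambda>x. x powr s)"
proof (rule convex_on_linorderI)
  fix t x y :: real
  assume t: "0 < t" "t < 1" and xy: "x \<in> {0..}" "y \<in> {0..}" "x < y"
  show "((1 - t) *\<^sub>R x + t *\<^sub>R y) powr s \<le> (1 - t) * x powr s + t * y powr s"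
  proof (cases "x = 0")
    case True
    have "t powr s \<le> t powr 1" using t assms by (intro powr_mono') auto
    then show ?thesis using True t xy assms by (simp add: powr_mult mult_right_mono)
  next
    case False
    then show ?thesis using convex_onD[OF powr_convex[OF assms], of t x y] t xy by simp
  qed
qed simp

text \<open>Jensen's inequality with the uniform weights \<open>1 / d\<close>.\<close>

lemma sample_mean_powr_le:
  assumes "s \<ge> 1" "d \<ge> 1" "\<And>j. 0 \<le> Z j \<omega>"
  shows "sample_mean d Z \<omega> powr s \<le> sample_mean d (\<lambda>j \<omega>. Z j \<omega> powr s) \<omega>"
proof -
  have "(\<Sum>j\<in>{1..d}. (1 / real d) *\<^sub>R Z j \<omega>) powr s \<le> (\<Sum>j\<in>{1..d}. (1 / real d) * Z j \<omega> powr s)"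
    using assms by (intro convex_on_sum[OF _ _ powr_convex_on_nonneg]) auto
  then show ?thesis by (simp add: sample_mean_def sum_divide_distrib)
qed

text \<open>Write \<open>a + b\<close> as the convex combination of \<open>a / (1 - t)\<close> and
  \<open>b / t\<close> with weights \<open>1 - t\<close> and \<open>t\<close>. As \<open>t\<close>
  tends to 0 the factor of \<open>a powr s\<close> tends to 1; the factor of \<open>b powr s\<close>
  may blow up, so \<open>b\<close> must be made small first.\<close>

lemma powr_add_le_weighted:
  fixes a b t s :: real
  assumes "s \<ge> 1" "0 < t" "t < 1" "0 \<le> a" "0 \<le> b"
  shows "(a + b) powr s \<le> (1 - t) / (1 - t) powr s * a powr s + t / t powr s * b powr s"
  using convex_onD[OF powr_convex_on_nonneg[OF assms(1)], of t "a / (1 - t)" "b / t"] assms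
  by (simp add: powr_divide)

section \<open>Nonnegative samples and their truncations\<close>

text \<open>\<open>X\<close> and \<open>Y\<close> play the role of the \<open>p\<close>-th absolute
  powers of the original variables, which are nonnegative at every point. Each \<open>d\<close> has
  its own space, as in a triangular array.\<close>

locale nonneg_iid_samples =
  fixes N :: "'a measure" and X :: "'a \<Rightarrow> real"
    and M :: "nat \<Rightarrow> 'b measure" and Y :: "nat \<Rightarrow> nat \<Rightarrow> 'b \<Rightarrow> real"
  assumes prob_N: "prob_space N" and X [measurable]: "X \<in> borel_measurable N"
    and prob_M: "\<And>d. d \<ge> 1 \<Longrightarrow> prob_space (M d)"
    and iid: "\<And>d. d \<ge> 1 \<Longrightarrow> iid_copies N X (M d) d (Y d)"
    and X_nonneg: "\<And>\<omega>. 0 \<le> X \<omega>" and Y_nonneg: "\<And>d j \<omega>. 0 \<le> Y d j \<omega>"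
begin

sublocale N: prob_space N by (rule prob_N)

text \<open>For absolute \<open>p\<close>-th powers and \<open>s = r / p\<close> this is the scaled
  moment of the \<open>p\<close>-norm when \<open>d \<ge> 1\<close>.\<close>

definition mean_moment :: "real \<Rightarrow> nat \<Rightarrow> ennreal" where
  "mean_moment s d = (\<integral>\<^sup>+\<omega>. ennreal (sample_mean d (Y d) \<omega> powr s) \<partial>M d)"

lemma truncated_mean_moment_LIMSEQ:
  assumes "K > 0" "s > 0"
  shows "(\<lambda>d. \<integral>\<^sup>+\<omega>. ennreal (sample_mean d (\<lambda>j \<omega>. min (Y d j \<omega>) K) \<omega> powr s) \<partial>M d)
           \<longlonglongrightarrow> ennreal ((\<integral>\<omega>. min (X \<omega>) K \<partial>N) powr s)"
proof (rule sample_mean_powr_bounded_LIMSEQ[OF assms prob_N _ _ prob_M])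
  show "iid_copies N (\<lambda>\<omega>. min (X \<omega>) K) (M d) d (\<lambda>j \<omega>. min (Y d j \<omega>) K)" if "d \<ge> 1" for d
    by (rule iid_copies_compose[OF iid[OF that] prob_M[OF that] X]) simp
qed (use assms X_nonneg Y_nonneg in auto)

lemma integrable_truncated: "integrable N (\<lambda>\<omega>. min (X \<omega>) (real k))"
  using X_nonneg by (intro N.integrable_const_bound[where B = "real k"]) auto

text \<open>Monotone convergence; the limit may be infinite. The levels are \<open>Suc k\<close>
  because the bounded case needs a positive level.\<close>

lemma truncated_mean_LIMSEQ:
  "(\<lambda>k. ennreal (\<integral>\<omega>. min (X \<omega>) (real (Suc k)) \<partial>N)) \<longlonglongrightarrow> (\<integral>\<^sup>+\<omega>. ennreal (X \<omega>) \<partial>N)"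
proof -
  have "(\<lambda>k. \<integral>\<^sup>+\<omega>. ennreal (min (X \<omega>) (real (Suc k))) \<partial>N) \<longlonglongrightarrow> (\<integral>\<^sup>+\<omega>. ennreal (X \<omega>) \<partial>N)"
  proof (rule nn_integral_LIMSEQ)
    show "incseq (\<lambda>k \<omega>. ennreal (min (X \<omega>) (real (Suc k))))"
      by (auto simp: incseq_def le_fun_def intro!: ennreal_leI)
    show "(\<lambda>k. ennreal (min (X \<omega>) (real (Suc k)))) \<longlonglongrightarrow> ennreal (X \<omega>)" for \<omega>
    proof (rule tendsto_eventually)
      show "\<forall>\<^sub>F k in sequentially. ennreal (min (X \<omega>) (real (Suc k))) = ennreal (X \<omega>)"
        using eventually_ge_at_top[of "nat \<lceil>X \<omega>\<rceil>"] by eventually_elim (auto simp: min_def)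
    qed
  qed simp
  moreover have "(\<integral>\<^sup>+\<omega>. ennreal (min (X \<omega>) (real (Suc k))) \<partial>N) = ennreal (\<integral>\<omega>. min (X \<omega>) (real (Suc k)) \<partial>N)" for k
    using X_nonneg by (intro nn_integral_eq_integral integrable_truncated) auto
  ultimately show ?thesis by simp
qed

section \<open>Lower bounds by truncation\<close>

text \<open>Truncation only lowers the sample mean, and the truncated moments converge by the
  bounded case.\<close>

lemma liminf_mean_moment_ge_truncated:
  assumes "K > 0" "s > 0"
  shows "ennreal ((\<integral>\<omega>. min (X \<omega>) K \<partial>N) powr s) \<le> liminf (mean_moment s)"
proof -
  have "ennreal ((\<integral>\<omega>. min (X \<omega>) K \<partial>N) powr s)
      = liminf (\<lambda>d. \<integral>\<^sup>+\<omega>. ennreal (sample_mean d (\<lambda>j \<omega>. min (Y d j \<omega>) K) \<omega> powr s) \<partial>M d)"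
    using lim_imp_Liminf[OF _ truncated_mean_moment_LIMSEQ[OF assms]] by simp
  also have "\<dots> \<le> liminf (mean_moment s)"
    unfolding mean_moment_def using assms Y_nonneg
    by (intro Liminf_mono always_eventually allI nn_integral_mono ennreal_leI powr_mono2
          sample_mean_mono sample_mean_nonneg) auto
  finally show ?thesis .
qed

lemma liminf_mean_moment_ge:
  assumes "s > 0" and int: "integrable N X"
  shows "ennreal ((\<integral>\<omega>. X \<omega> \<partial>N) powr s) \<le> liminf (mean_moment s)"
proof (rule LIMSEQ_le_const2)
  have "(\<lambda>k. ennreal (\<integral>\<omega>. min (X \<omega>) (real (Suc k)) \<partial>N)) \<longlonglongrightarrow> ennreal (\<integral>\<omega>. X \<omega> \<partial>N)"
    using truncated_mean_LIMSEQ nn_integral_eq_integral[OF int] X_nonneg by simp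
  \<comment> \<open>The limit is finite here, so it may be taken in the reals, where the power is
    continuous.\<close>
  then have "(\<lambda>k. \<integral>\<omega>. min (X \<omega>) (real (Suc k)) \<partial>N) \<longlonglongrightarrow> (\<integral>\<omega>. X \<omega> \<partial>N)"
    using X_nonneg by (subst (asm) tendsto_ennreal_iff) (auto intro!: always_eventually)
  then show "(\<lambda>k. ennreal ((\<integral>\<omega>. min (X \<omega>) (real (Suc k)) \<partial>N) powr s)) \<longlonglongrightarrow> ennreal ((\<integral>\<omega>. X \<omega> \<partial>N) powr s)"
    using X_nonneg \<open>s > 0\<close> by (intro tendsto_ennrealI tendsto_powr2 tendsto_const) (auto intro!: always_eventually)
  show "\<exists>n. \<forall>k\<ge>n. ennreal ((\<integral>\<omega>. min (X \<omega>) (real (Suc k)) \<partial>N) powr s) \<le> liminf (mean_moment s)"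
    using liminf_mean_moment_ge_truncated \<open>s > 0\<close> by auto
qed

text \<open>The truncated expectations grow without bound, hence so do their \<open>s\<close>-th
  powers, each of which bounds the limit inferior from below.\<close>

lemma mean_moment_LIMSEQ_top:
  assumes "s > 0" and inf: "(\<integral>\<^sup>+\<omega>. ennreal (X \<omega>) \<partial>N) = \<infinity>"
  shows "mean_moment s \<longlonglongrightarrow> \<infinity>"
proof -
  let ?m = "\<lambda>k. \<integral>\<omega>. min (X \<omega>) (real (Suc k)) \<partial>N"
  have m: "filterlim ?m at_top sequentially"
    using truncated_mean_LIMSEQ inf by (simp add: ennreal_tendsto_top_eq_at_top)
  have "filterlim (\<lambda>k. ?m k powr s) at_top sequentially"
    unfolding filterlim_at_top
  proof
    fix C :: real
    \<comment> \<open>The threshold is the number whose \<open>s\<close>-th power is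
      \<open>\<bar>C\<bar>\<close>, which is at least \<open>C\<close>.\<close>
    have "\<forall>\<^sub>F k in sequentially. \<bar>C\<bar> powr (1 / s) \<le> ?m k" using m by (simp add: filterlim_at_top)
    then show "\<forall>\<^sub>F k in sequentially. C \<le> ?m k powr s"
    proof eventually_elim
      case (elim k)
      have "C \<le> (\<bar>C\<bar> powr (1 / s)) powr s" using \<open>s > 0\<close> by (simp add: powr_powr)
      also have "\<dots> \<le> ?m k powr s" using elim \<open>s > 0\<close> by (intro powr_mono2) auto
      finally show ?case .
    qed
  qed
  then have "(\<lambda>k. ennreal (?m k powr s)) \<longlonglongrightarrow> \<infinity>"
    by (simp add: ennreal_tendsto_top_eq_at_top)
  then have "\<infinity> \<le> liminf (mean_moment s)"
    by (rule LIMSEQ_le_const2) (use liminf_mean_moment_ge_truncated \<open>s > 0\<close> in auto)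
  then have "liminf (mean_moment s) = \<infinity>" by (simp add: top_unique)
  moreover from this have "limsup (mean_moment s) = \<infinity>"
    using Liminf_le_Limsup[of sequentially "mean_moment s"] by (simp add: top_unique)
  ultimately show ?thesis by (simp add: tendsto_iff_Liminf_eq_Limsup)
qed

section \<open>Upper bound for exponents below 1\<close>

text \<open>Jensen's inequality for a concave power: the tangent line at the expectation is
  integrated. At expectation \<open>0\<close> there is no finite slope, but then the sample mean
  vanishes almost everywhere.\<close>

lemma mean_moment_le:
  assumes s: "0 < s" "s < 1" and int: "integrable N X" and d: "d \<ge> 1"
  shows "mean_moment s d \<le> ennreal ((\<integral>\<omega>. X \<omega> \<partial>N) powr s)"
proof -
  let ?A = "sample_mean d (Y d)" and ?m = "\<integral>\<omega>. X \<omega> \<partial>N"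
  interpret prob_space "M d" using prob_M d .
  have [measurable]: "?A \<in> borel_measurable (M d)"
    using sample_mean_measurable[OF iid[OF d] prob_M[OF d]] .
  have A: "0 \<le> ?A \<omega>" for \<omega> using Y_nonneg by (intro sample_mean_nonneg)
  have EA: "(\<integral>\<^sup>+\<omega>. ennreal (?A \<omega>) \<partial>M d) = ennreal ?m"
    using nn_integral_sample_mean[OF iid[OF d] prob_M[OF d] d X Y_nonneg] nn_integral_eq_integral[OF int] X_nonneg
    by simp
  have m: "0 \<le> ?m" using X_nonneg by simp
  show ?thesis
  proof (cases "?m = 0")
    case True
    then have "AE \<omega> in M d. ?A \<omega> = 0"
      using EA A by (simp add: nn_integral_0_iff_AE)
    then have "mean_moment s d = (\<integral>\<^sup>+\<omega>. 0 \<partial>M d)"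
      unfolding mean_moment_def using s by (intro nn_integral_cong_AE) auto
    then show ?thesis by simp
  next
    case False
    with m have m: "0 < ?m" by simp
    \<comment> \<open>This is the tangent line at \<open>?m\<close>, obtained from Young's
      inequality for \<open>?A \<omega>\<close> and \<open>?m\<close> with weights \<open>s\<close>
      and \<open>1 - s\<close>.\<close>
    have "?A \<omega> powr s \<le> ?m powr (s - 1) * s * ?A \<omega> + (1 - s) * ?m powr s" for \<omega>
    proof (cases "?A \<omega> = 0")
      case False
      have "?A \<omega> powr s = ?m powr (s - 1) * (?A \<omega> powr s * ?m powr (1 - s))"
        using m by (simp add: powr_add[symmetric])
      also have "\<dots> \<le> ?m powr (s - 1) * (s * ?A \<omega> + (1 - s) * ?m)"
        using A[of \<omega>] False m s by (intro mult_left_mono Youngs_inequality_0) auto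
      also have "\<dots> = ?m powr (s - 1) * s * ?A \<omega> + (1 - s) * (?m powr (s - 1) * ?m powr 1)"
        using m by (simp add: algebra_simps)
      also have "?m powr (s - 1) * ?m powr 1 = ?m powr s"
        by (simp only: powr_add[symmetric]) simp
      finally show ?thesis .
    qed (use s in auto)
    then have "mean_moment s d \<le> (\<integral>\<^sup>+\<omega>. ennreal (?m powr (s - 1) * s) * ennreal (?A \<omega>) + ennreal ((1 - s) * ?m powr s) \<partial>M d)"
      unfolding mean_moment_def using s A
      by (intro nn_integral_mono) (simp add: ennreal_mult[symmetric] ennreal_plus[symmetric] ennreal_leI del: ennreal_plus)
    also have "\<dots> = ennreal (?m powr (s - 1) * s) * ennreal ?m + ennreal ((1 - s) * ?m powr s)"
      by (simp add: nn_integral_add nn_integral_cmult EA emeasure_space_1)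
    also have "\<dots> = ennreal (s * (?m powr (s - 1) * ?m powr 1) + (1 - s) * ?m powr s)"
      using s m by (simp add: ennreal_mult[symmetric] ennreal_plus[symmetric] mult_ac del: ennreal_plus)
    also have "?m powr (s - 1) * ?m powr 1 = ?m powr s"
      by (simp only: powr_add[symmetric]) simp
    also have "s * ?m powr s + (1 - s) * ?m powr s = ?m powr s" by (simp add: algebra_simps)
    finally show ?thesis .
  qed
qed

section \<open>Upper bound for exponents at least 1\<close>

text \<open>The sample mean is the truncated mean plus the mean of the excesses over
  \<open>K\<close>. Jensen's inequality bounds the power of the latter by a mean of powers, whose
  expectation does not depend on \<open>d\<close>.\<close>

lemma mean_moment_le_split:
  assumes s: "s \<ge> 1" and t: "0 < t" "t < 1" and d: "d \<ge> 1" and K: "K \<ge> 0"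
  shows "mean_moment s d \<le>
      ennreal ((1 - t) / (1 - t) powr s) * (\<integral>\<^sup>+\<omega>. ennreal (sample_mean d (\<lambda>j \<omega>. min (Y d j \<omega>) K) \<omega> powr s) \<partial>M d)
    + ennreal (t / t powr s) * (\<integral>\<^sup>+\<omega>. ennreal ((X \<omega> - min (X \<omega>) K) powr s) \<partial>N)"
    (is "_ \<le> ennreal ?a * _ + ennreal ?b * _")
proof -
  let ?U = "sample_mean d (\<lambda>j \<omega>. min (Y d j \<omega>) K)"
  let ?W = "sample_mean d (\<lambda>j \<omega>. Y d j \<omega> - min (Y d j \<omega>) K)"
  let ?V = "sample_mean d (\<lambda>j \<omega>. (Y d j \<omega> - min (Y d j \<omega>) K) powr s)"
  have iid_U: "iid_copies N (\<lambda>\<omega>. min (X \<omega>) K) (M d) d (\<lambda>j \<omega>. min (Y d j \<omega>) K)"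
    by (rule iid_copies_compose[OF iid[OF d] prob_M[OF d] X]) simp
  have iid_V: "iid_copies N (\<lambda>\<omega>. (X \<omega> - min (X \<omega>) K) powr s) (M d) d (\<lambda>j \<omega>. (Y d j \<omega> - min (Y d j \<omega>) K) powr s)"
    by (rule iid_copies_compose[OF iid[OF d] prob_M[OF d] X, of "\<lambda>x. (x - min x K) powr s"]) simp
  note [measurable] = sample_mean_measurable[OF iid_U prob_M[OF d]] sample_mean_measurable[OF iid_V prob_M[OF d]]
  have "ennreal (sample_mean d (Y d) \<omega> powr s) \<le> ennreal ?a * ennreal (?U \<omega> powr s) + ennreal ?b * ennreal (?V \<omega>)" for \<omega>
  proof -
    have pos: "0 \<le> ?U \<omega>" "0 \<le> ?W \<omega>" "0 \<le> ?V \<omega>"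
      using K Y_nonneg by (auto intro!: sample_mean_nonneg)
    have "sample_mean d (Y d) \<omega> powr s = (?U \<omega> + ?W \<omega>) powr s"
      by (simp add: sample_mean_def add_divide_distrib[symmetric] sum.distrib[symmetric])
    also have "\<dots> \<le> ?a * ?U \<omega> powr s + ?b * ?W \<omega> powr s"
      using s t pos by (intro powr_add_le_weighted)
    also have "\<dots> \<le> ?a * ?U \<omega> powr s + ?b * ?V \<omega>"
      using s d t by (intro add_left_mono mult_left_mono sample_mean_powr_le) auto
    finally have "ennreal (sample_mean d (Y d) \<omega> powr s) \<le> ennreal (?a * ?U \<omega> powr s + ?b * ?V \<omega>)"
      by (rule ennreal_leI)
    also have "\<dots> = ennreal ?a * ennreal (?U \<omega> powr s) + ennreal ?b * ennreal (?V \<omega>)"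
      using t pos by (simp add: ennreal_mult[symmetric] ennreal_plus[symmetric] del: ennreal_plus)
    finally show ?thesis .
  qed
  then have "mean_moment s d \<le> (\<integral>\<^sup>+\<omega>. ennreal ?a * ennreal (?U \<omega> powr s) + ennreal ?b * ennreal (?V \<omega>) \<partial>M d)"
    unfolding mean_moment_def by (intro nn_integral_mono)
  also have "\<dots> = ennreal ?a * (\<integral>\<^sup>+\<omega>. ennreal (?U \<omega> powr s) \<partial>M d) + ennreal ?b * (\<integral>\<^sup>+\<omega>. ennreal (?V \<omega>) \<partial>M d)"
    by (simp add: nn_integral_add nn_integral_cmult)
  also have "(\<integral>\<^sup>+\<omega>. ennreal (?V \<omega>) \<partial>M d) = (\<integral>\<^sup>+\<omega>. ennreal ((X \<omega> - min (X \<omega>) K) powr s) \<partial>N)"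
    by (rule nn_integral_sample_mean[OF iid_V prob_M[OF d] d]) auto
  finally show ?thesis .
qed

text \<open>Dominated convergence with majorant \<open>X \<omega> powr s\<close>; at each point the
  excess is eventually \<open>0\<close>.\<close>

lemma excess_moment_LIMSEQ:
  assumes s: "s > 0" and fin: "(\<integral>\<^sup>+\<omega>. ennreal (X \<omega> powr s) \<partial>N) < \<infinity>"
  shows "(\<lambda>k. \<integral>\<^sup>+\<omega>. ennreal ((X \<omega> - min (X \<omega>) (real (Suc k))) powr s) \<partial>N) \<longlonglongrightarrow> 0"
proof -
  have "(\<lambda>k. \<integral>\<^sup>+\<omega>. ennreal ((X \<omega> - min (X \<omega>) (real (Suc k))) powr s) \<partial>N) \<longlonglongrightarrow> (\<integral>\<^sup>+\<omega>. 0 \<partial>N)"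
  proof (rule nn_integral_dominated_convergence[OF _ _ _ _ fin])
    show "AE \<omega> in N. ennreal ((X \<omega> - min (X \<omega>) (real (Suc k))) powr s) \<le> ennreal (X \<omega> powr s)" for k
      using X_nonneg s by (intro AE_I2 ennreal_leI powr_mono2) auto
    show "AE \<omega> in N. (\<lambda>k. ennreal ((X \<omega> - min (X \<omega>) (real (Suc k))) powr s)) \<longlonglongrightarrow> 0"
    proof (intro AE_I2 tendsto_eventually)
      show "\<forall>\<^sub>F k in sequentially. ennreal ((X \<omega> - min (X \<omega>) (real (Suc k))) powr s) = 0" for \<omega>
        using eventually_ge_at_top[of "nat \<lceil>X \<omega>\<rceil>"] by eventually_elim (auto simp: min_def)
    qed
  qed simp_all
  then show ?thesis by simp
qed

text \<open>The order of limits matters: first \<open>d\<close> with level and \<open>t\<close>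
  fixed, then the level, which removes the excess term despite its large factor, and last
  \<open>t\<close>.\<close>

lemma limsup_mean_moment_le:
  assumes s: "s \<ge> 1" and int: "integrable N X" and fin: "(\<integral>\<^sup>+\<omega>. ennreal (X \<omega> powr s) \<partial>N) < \<infinity>"
  shows "limsup (mean_moment s) \<le> ennreal ((\<integral>\<omega>. X \<omega> \<partial>N) powr s)"
proof -
  let ?m = "\<integral>\<omega>. X \<omega> \<partial>N"
  let ?a = "\<lambda>t::real. (1 - t) / (1 - t) powr s"
  have bound: "limsup (mean_moment s) \<le> ennreal (?a t) * ennreal (?m powr s)" if t: "0 < t" "t < 1" for t
  proof (rule LIMSEQ_le_const)
    let ?e = "\<lambda>k. \<integral>\<^sup>+\<omega>. ennreal ((X \<omega> - min (X \<omega>) (real (Suc k))) powr s) \<partial>N"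
    have "(\<lambda>k. ennreal (?a t) * ennreal (?m powr s) + ennreal (t / t powr s) * ?e k) \<longlonglongrightarrow>
        ennreal (?a t) * ennreal (?m powr s) + ennreal (t / t powr s) * 0"
      using excess_moment_LIMSEQ[OF _ fin] s
      by (intro tendsto_add tendsto_const ennreal_tendsto_cmult) auto
    then show "(\<lambda>k. ennreal (?a t) * ennreal (?m powr s) + ennreal (t / t powr s) * ?e k) \<longlonglongrightarrow>
        ennreal (?a t) * ennreal (?m powr s)" by simp
    \<comment> \<open>At a fixed level only the truncated term depends on \<open>d\<close>, and it
      converges; the truncated expectation is then replaced by the larger full one.\<close>
    have "limsup (mean_moment s) \<le> ennreal (?a t) * ennreal (?m powr s) + ennreal (t / t powr s) * ?e k" for k
    proof -
      let ?U = "\<lambda>d. \<integral>\<^sup>+\<omega>. ennreal (sample_mean d (\<lambda>j \<omega>. min (Y d j \<omega>) (real (Suc k))) \<omega> powr s) \<partial>M d"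
      let ?mk = "\<integral>\<omega>. min (X \<omega>) (real (Suc k)) \<partial>N"
      have "?U \<longlonglongrightarrow> ennreal (?mk powr s)"
        using s by (intro truncated_mean_moment_LIMSEQ) auto
      then have "(\<lambda>d. ennreal (?a t) * ?U d + ennreal (t / t powr s) * ?e k) \<longlonglongrightarrow>
          ennreal (?a t) * ennreal (?mk powr s) + ennreal (t / t powr s) * ?e k"
        by (intro tendsto_add tendsto_const ennreal_tendsto_cmult) auto
      then have lim_U: "limsup (\<lambda>d. ennreal (?a t) * ?U d + ennreal (t / t powr s) * ?e k) =
          ennreal (?a t) * ennreal (?mk powr s) + ennreal (t / t powr s) * ?e k"
        by (intro lim_imp_Limsup) simp_all
      have le_U: "limsup (mean_moment s) \<le> limsup (\<lambda>d. ennreal (?a t) * ?U d + ennreal (t / t powr s) * ?e k)"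
        by (intro Limsup_mono eventually_mono[OF eventually_ge_at_top[of "1::nat"]] mean_moment_le_split s t) auto
      have "?mk powr s \<le> ?m powr s"
        using s X_nonneg int integrable_truncated[of "Suc k"] by (intro powr_mono2 integral_mono) auto
      then have mono: "ennreal (?a t) * ennreal (?mk powr s) + ennreal (t / t powr s) * ?e k
          \<le> ennreal (?a t) * ennreal (?m powr s) + ennreal (t / t powr s) * ?e k"
        by (intro add_right_mono mult_left_mono ennreal_leI) auto
      show ?thesis by (rule order_trans[OF le_U[unfolded lim_U] mono])
    qed
    then show "\<exists>n. \<forall>k\<ge>n. limsup (mean_moment s) \<le> ennreal (?a t) * ennreal (?m powr s) + ennreal (t / t powr s) * ?e k"
      by blast
  qed
  \<comment> \<open>The excess term is gone, so \<open>t\<close> may tend to 0 and the remaining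
    factor to 1.\<close>
  have "(?a \<longlongrightarrow> (1 - 0) / (1 - 0) powr s) (at_right 0)"
    by (intro tendsto_intros) auto
  then have "((\<lambda>t. ?a t * ?m powr s) \<longlongrightarrow> 1 * ?m powr s) (at_right 0)"
    by (intro tendsto_mult tendsto_const) simp
  then have "((\<lambda>t. ennreal (?a t * ?m powr s)) \<longlongrightarrow> ennreal (?m powr s)) (at_right 0)"
    by (intro tendsto_ennrealI) simp
  moreover have "\<forall>\<^sub>F t in at_right 0. limsup (mean_moment s) \<le> ennreal (?a t * ?m powr s)"
    using eventually_at_right_real[of 0 1]
    by (rule eventually_mono) (use bound in \<open>auto simp: ennreal_mult[symmetric]\<close>)
  ultimately show ?thesis
    by (intro tendsto_lowerbound) auto
qed

section \<open>Infinite moments, integrability and convergence\<close>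

text \<open>One coordinate suffices: the mean is at least \<open>Y d 1 \<omega> / d\<close>, whose
  \<open>s\<close>-th moment is infinite for each fixed \<open>d\<close>.\<close>

lemma mean_moment_eq_top:
  assumes s: "s > 0" and inf: "(\<integral>\<^sup>+\<omega>. ennreal (X \<omega> powr s) \<partial>N) = \<infinity>" and d: "d \<ge> 1"
  shows "mean_moment s d = \<infinity>"
proof -
  have 1: "1 \<in> {1..d}" using d by simp
  note [measurable] = iid_copies_measurable[OF iid[OF d] prob_M[OF d] 1]
  have "\<infinity> = ennreal (1 / real d powr s) * (\<integral>\<^sup>+\<omega>. ennreal (X \<omega> powr s) \<partial>N)"
    using d inf by (simp add: ennreal_mult_top)
  also have "(\<integral>\<^sup>+\<omega>. ennreal (X \<omega> powr s) \<partial>N) = (\<integral>\<^sup>+\<omega>. ennreal (Y d 1 \<omega> powr s) \<partial>M d)"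
    by (rule iid_copies_nn_integral[OF iid[OF d] prob_M[OF d] 1 X, symmetric]) simp
  also have "ennreal (1 / real d powr s) * \<dots> = (\<integral>\<^sup>+\<omega>. ennreal (1 / real d powr s) * ennreal (Y d 1 \<omega> powr s) \<partial>M d)"
    by (rule nn_integral_cmult[symmetric]) measurable
  also have "\<dots> \<le> mean_moment s d"
    unfolding mean_moment_def
  proof (rule nn_integral_mono)
    fix \<omega>
    have "Y d 1 \<omega> \<le> (\<Sum>j = 1..d. Y d j \<omega>)"
      using 1 Y_nonneg by (intro member_le_sum) auto
    then have "(Y d 1 \<omega> / real d) powr s \<le> sample_mean d (Y d) \<omega> powr s"
      unfolding sample_mean_def using s Y_nonneg by (intro powr_mono2 divide_right_mono) auto
    then show "ennreal (1 / real d powr s) * ennreal (Y d 1 \<omega> powr s) \<le> ennreal (sample_mean d (Y d) \<omega> powr s)"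
      using Y_nonneg by (simp add: ennreal_mult[symmetric] powr_divide ennreal_leI)
  qed
  finally show ?thesis by (simp add: top_unique)
qed

text \<open>On a probability space this follows from \<open>x \<le> 1 + x powr s\<close> for
  \<open>x \<ge> 0\<close>.\<close>

lemma integrable_if_powr:
  assumes s: "s \<ge> 1" and fin: "(\<integral>\<^sup>+\<omega>. ennreal (X \<omega> powr s) \<partial>N) < \<infinity>"
  shows "integrable N X"
proof (rule integrableI_nonneg)
  have "X \<omega> \<le> 1 + X \<omega> powr s" for \<omega>
  proof (cases "X \<omega> \<le> 1")
    case False
    then have "X \<omega> powr 1 \<le> X \<omega> powr s" using s by (intro powr_mono) auto
    then show ?thesis using False by simp
  qed (simp add: add_increasing2)
  then have "(\<integral>\<^sup>+\<omega>. ennreal (X \<omega>) \<partial>N) \<le> (\<integral>\<^sup>+\<omega>. 1 + ennreal (X \<omega> powr s) \<partial>N)"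
    by (intro nn_integral_mono) (simp add: ennreal_plus[symmetric] ennreal_leI del: ennreal_plus flip: ennreal_1)
  also have "\<dots> < \<infinity>"
    using fin by (simp add: nn_integral_add N.emeasure_space_1)
  finally show "(\<integral>\<^sup>+\<omega>. ennreal (X \<omega>) \<partial>N) < \<infinity>" .
qed (use X_nonneg in auto)

text \<open>The truncation lower bound serves every \<open>s > 0\<close>. The upper bound is
  concavity for \<open>s < 1\<close> and the splitting argument otherwise, where the
  \<open>s\<close>-th moment must be finite too.\<close>

lemma mean_moment_LIMSEQ:
  assumes s: "s > 0" and int: "integrable N X" and fin: "s \<ge> 1 \<Longrightarrow> (\<integral>\<^sup>+\<omega>. ennreal (X \<omega> powr s) \<partial>N) < \<infinity>"
  shows "mean_moment s \<longlonglongrightarrow> ennreal ((\<integral>\<omega>. X \<omega> \<partial>N) powr s)"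
proof (rule Liminf_eq_Limsup)
  have upper: "limsup (mean_moment s) \<le> ennreal ((\<integral>\<omega>. X \<omega> \<partial>N) powr s)"
  proof (cases "s < 1")
    case True
    then show ?thesis
      using s int by (intro Limsup_bounded eventually_mono[OF eventually_ge_at_top[of "1::nat"]] mean_moment_le)
  next
    case False
    then show ?thesis using int fin by (intro limsup_mean_moment_le) auto
  qed
  note lower = liminf_mean_moment_ge[OF s int]
  have le: "liminf (mean_moment s) \<le> limsup (mean_moment s)" by (rule Liminf_le_Limsup) simp
  show "liminf (mean_moment s) = ennreal ((\<integral>\<omega>. X \<omega> \<partial>N) powr s)"
    using le upper lower by (meson antisym order_trans)
  show "limsup (mean_moment s) = ennreal ((\<integral>\<omega>. X \<omega> \<partial>N) powr s)"
    using le upper lower by (meson antisym order_trans)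
qed simp

end

section \<open>Reduction of \<open>p\<close>-norms to sample means\<close>

theorem corollary1:
  fixes p r :: real
    and N :: "'a measure" and X :: "'a \<Rightarrow> real"
    and M :: "nat \<Rightarrow> 'b measure" and Y :: "nat \<Rightarrow> nat \<Rightarrow> 'b \<Rightarrow> real"
  assumes "p > 0" and "r > 0"
    and "prob_space N" and "X \<in> borel_measurable N"
    and "\<And>d. d \<ge> 1 \<Longrightarrow> prob_space (M d)"
    and "\<And>d. d \<ge> 1 \<Longrightarrow> iid_copies N X (M d) d (Y d)"
  shows "(r / p < 1 \<and> abs_moment N X p < \<infinity> \<longrightarrow>
            (\<lambda>d. scaled_pnorm_moment p r (M d) d (Y d)) \<longlonglongrightarrow> ennreal (mu N X p powr (r / p)))
       \<and> (r / p < 1 \<and> abs_moment N X p = \<infinity> \<longrightarrow>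
            (\<lambda>d. scaled_pnorm_moment p r (M d) d (Y d)) \<longlonglongrightarrow> \<infinity>)
       \<and> (r / p \<ge> 1 \<and> abs_moment N X r < \<infinity> \<longrightarrow>
            (\<lambda>d. scaled_pnorm_moment p r (M d) d (Y d)) \<longlonglongrightarrow> ennreal (mu N X p powr (r / p)))
       \<and> (r / p \<ge> 1 \<and> abs_moment N X r = \<infinity> \<longrightarrow>
            (\<forall>d\<ge>1. scaled_pnorm_moment p r (M d) d (Y d) = \<infinity>))"
proof -
  define s where "s = r / p"
  let ?X = "\<lambda>\<omega>. \<bar>X \<omega>\<bar> powr p" and ?Y = "\<lambda>d j \<omega>. \<bar>Y d j \<omega>\<bar> powr p"
  have s: "s > 0" using assms by (simp add: s_def)
  note [measurable] = assms(4)
  have iid: "iid_copies N ?X (M d) d (?Y d)" if "d \<ge> 1" for d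
    by (rule iid_copies_compose[OF assms(6)[OF that] assms(5)[OF that] assms(4), of "\<lambda>x. \<bar>x\<bar> powr p"]) simp
  interpret nonneg_iid_samples N ?X M ?Y
    by (rule nonneg_iid_samples.intro[OF assms(3) _ assms(5) iid]) simp_all
  \<comment> \<open>Pointwise, the \<open>r\<close>-th power of the norm is the sum raised to
    \<open>r / p\<close>, so the scaling moves inside as division by \<open>d\<close>, which is
    nonzero here.\<close>
  have eq: "scaled_pnorm_moment p r (M d) d (Y d) = mean_moment s d" if d: "d \<ge> 1" for d
  proof -
    have [measurable]: "(\<lambda>\<omega>. \<Sum>j = 1..d. \<bar>Y d j \<omega>\<bar> powr p) \<in> borel_measurable (M d)"
      using iid_copies_measurable[OF iid[OF d] assms(5)[OF d]] by (rule borel_measurable_sum)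
    have meas: "(\<lambda>\<omega>. ennreal (pnorm p d (\<lambda>j. Y d j \<omega>) powr r)) \<in> borel_measurable (M d)"
      unfolding pnorm_def by measurable
    have "ennreal (pnorm p d (\<lambda>j. Y d j \<omega>) powr r) / ennreal (real d powr (r / p))
        = ennreal (sample_mean d (?Y d) \<omega> powr s)" for \<omega>
      using d \<open>p > 0\<close>
      by (simp add: pnorm_def sample_mean_def s_def powr_powr powr_divide divide_ennreal sum_nonneg)
    with meas show ?thesis
      unfolding scaled_pnorm_moment_def mean_moment_def by (simp flip: nn_integral_divide)
  qed
  have lim_eq: "(\<lambda>d. scaled_pnorm_moment p r (M d) d (Y d)) \<longlonglongrightarrow> l \<longleftrightarrow> mean_moment s \<longlonglongrightarrow> l" for l
    using eq by (intro tendsto_cong eventually_mono[OF eventually_ge_at_top[of "1::nat"]])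
  have mom_p: "abs_moment N X p = (\<integral>\<^sup>+\<omega>. ennreal (?X \<omega>) \<partial>N)" by (simp add: abs_moment_def)
  have mom_r: "abs_moment N X r = (\<integral>\<^sup>+\<omega>. ennreal (?X \<omega> powr s) \<partial>N)"
    using \<open>p > 0\<close> by (simp add: abs_moment_def powr_powr s_def)
  have int: "integrable N ?X" if "abs_moment N X p < \<infinity>"
    using that unfolding mom_p by (intro integrableI_nonneg) auto
  have "s < 1 \<and> abs_moment N X p < \<infinity> \<longrightarrow> mean_moment s \<longlonglongrightarrow> ennreal (mu N X p powr s)"
    unfolding mu_def using s int by (intro impI mean_moment_LIMSEQ) auto
  moreover have "s < 1 \<and> abs_moment N X p = \<infinity> \<longrightarrow> mean_moment s \<longlonglongrightarrow> \<infinity>"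
    using mean_moment_LIMSEQ_top[OF s] by (simp add: mom_p)
  \<comment> \<open>Here integrability of the \<open>p\<close>-th power is derived from the finite
    \<open>r\<close>-th moment by \<open>integrable_if_powr\<close>.\<close>
  moreover have "s \<ge> 1 \<and> abs_moment N X r < \<infinity> \<longrightarrow> mean_moment s \<longlonglongrightarrow> ennreal (mu N X p powr s)"
    unfolding mu_def mom_r using s integrable_if_powr by (intro impI mean_moment_LIMSEQ) auto
  moreover have "s \<ge> 1 \<and> abs_moment N X r = \<infinity> \<longrightarrow> (\<forall>d\<ge>1. mean_moment s d = \<infinity>)"
    using mean_moment_eq_top[OF s] by (simp add: mom_r)
  ultimately show ?thesis
    using eq unfolding lim_eq s_def[symmetric] by auto
qed

end
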